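(* Let $k\ge 2$, let $\alpha$ be a simple ordered rational $k$-cone in $\mathbb{R}^n$, and let $\sigma=(i,j)\in S_k$ be a transposition with $1\le i<j\le k$. (1) If $j<k$, then for every $x\in\{1,\ldots,k-1\}$ $$\operatorname{lcos}_{x,k}\alpha_\sigma=\operatorname{lcos}_{\sigma(x),k}\alpha .$$ (2) If $j=k$, then for every $x\in\{1,\ldots,k-1\}$ $$\operatorname{lcos}_{x,k}\alpha_\sigma\equiv\begin{cases}(\operatorname{lcos}_{i,k}\alpha)^{-1} \pmod{\operatorname{lsin}_k\alpha} & \text{if } x=i,\\ -\operatorname{lcos}_{x,k}\alpha\cdot(\operatorname{lcos}_{i,k}\alpha)^{-1} \pmod{\operatorname{lsin}_k\alpha} & \text{otherwise,}\end{cases}$$ where $(\cdot)^{-1}$ denotes the multiplicative inverse modulo $\operatorname{lsin}_k\alpha$.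
   Context: An ordered rational $k$-cone $\alpha$ in $\mathbb{R}^n$ ($k\le n$) is given by a vertex $A_0\in\mathbb{Z}^n$ and an ordered tuple $(v_1,\ldots,v_k)$ of linearly independent primitive integer vectors (its edge vectors); as a set it is $\{A_0+\sum\lambda_iv_i:\lambda_i\ge0\}$. Let $\Gamma=\mathbb{Z}^n\cap\operatorname{span}_{\mathbb{R}}(v_1,\ldots,v_k)$. There is a unique $\mathbb{Z}$-basis $e_1,\ldots,e_k$ of $\Gamma$ such that $v_i=\sum_{j\le i}a_{j,i}e_j$ with $a_{i,i}>0$ and $0\le a_{j,i}<a_{i,i}$ for $j<i$. The upper triangular matrix $(a_{j,i})$ is denoted $\operatorname{IARCTAN}(\alpha)$ (the normalised Hermite normal form). The $i$-th integer sine is $\operatorname{lsin}_i\alpha=a_{i,i}$ and the $(j,i)$-th integer cosine ($j<i$) is $\operatorname{lcos}_{j,i}\alpha=a_{j,i}$. The integer sine of a rational $m$-cone $\beta$ with primitive edge vectors $w_1,\ldots,w_m$ is the index $\operatorname{lsin}(\beta)=[\mathbb{Z}^n\cap\operatorname{span}_{\mathbb{R}}(w_1,\ldots,w_m):\mathbb{Z}w_1+\cdots+\mathbb{Z}w_m]$. The cone $\alpha$ is simple if every $(k-1)$-dimensional face $\beta$ of $\alpha$ (the cone with vertex $A_0$ generated by $k-1$ of the vectors $v_i$) satisfies $\operatorname{lsin}(\beta)=1$. For a simple cone the integers $\operatorname{lcos}_{i,k}\alpha$, $1\le i\le k-1$, are invertible modulo $\operatorname{lsin}_k\alpha$. For $s\in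 S_k$, $\alpha_s$ denotes the $s$-transpose of $\alpha$: the cone with the same vertex and with ordered edge vectors $(v_{s(1)},\ldots,v_{s(k)})$. *)

theory Defs
  imports "HOL-Analysis.Analysis" "HOL-Number_Theory.Modular_Inverse"
begin

text \<open>
  Integer vectors are elements of \<open>int ^ 'n\<close>, regarded as the free \<open>\<int>\<close>-module of rank
  \<open>CARD('n)\<close> under \<open>(*s)\<close>; real spans are taken after embedding them into \<open>real ^ 'n\<close>.
\<close>

interpretation int_vec: module "(*s) :: int \<Rightarrow> int ^ 'n \<Rightarrow> int ^ 'n"
  by unfold_locales
    (simp_all add: vector_add_ldistrib vector_sadd_rdistrib vector_smult_assoc)

definition of_int_vec :: "int ^ 'n \<Rightarrow> real ^ 'n" where
  "of_int_vec v = (\<chi> i. of_int (v $ i))"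

definition primitive_vec :: "int ^ 'n \<Rightarrow> bool" where
  "primitive_vec v \<longleftrightarrow> v \<noteq> 0 \<and> (GCD i. v $ i) = 1"

record ('n::finite) ordered_cone =
  vertex :: "int ^ 'n"
  edges :: "(int ^ 'n) list"

text \<open>Edge vectors are numbered from 1, as in \<open>(v\<^sub>1, \<dots>, v\<^sub>k)\<close>, whereas list positions start at 0.\<close>

definition edge :: "('n::finite) ordered_cone \<Rightarrow> nat \<Rightarrow> int ^ 'n" where
  "edge \<alpha> i = edges \<alpha> ! (i - 1)"

definition rational_cone :: "nat \<Rightarrow> ('n::finite) ordered_cone \<Rightarrow> bool" where
  "rational_cone k \<alpha> \<longleftrightarrow>
     length (edges \<alpha>) = k \<and>
     (\<forall>v\<in>set (edges \<alpha>). primitive_vec v) \<and>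
     distinct (edges \<alpha>) \<and> independent (of_int_vec ` set (edges \<alpha>))"

text \<open>The lattice \<open>\<Gamma> = \<int>\<^sup>n \<inter> span\<^sub>\<real> (v\<^sub>1, \<dots>, v\<^sub>k)\<close>.\<close>

definition cone_lattice :: "('n::finite) ordered_cone \<Rightarrow> (int ^ 'n) set" where
  "cone_lattice \<alpha> = {x. of_int_vec x \<in> span (of_int_vec ` set (edges \<alpha>))}"

definition zbasis :: "nat \<Rightarrow> (nat \<Rightarrow> int ^ 'n) \<Rightarrow> (int ^ 'n) set \<Rightarrow> bool" where
  "zbasis k e L \<longleftrightarrow>
     inj_on e {1..k} \<and> int_vec.independent (e ` {1..k}) \<and> int_vec.span (e ` {1..k}) = L"

text \<open>
  \<open>a j i\<close> is the entry in row \<open>j\<close> and column \<open>i\<close>. Entries outside the upper triangle of the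
  \<open>k \<times> k\<close> matrix are set to 0, so that the function \<open>a\<close> is determined by the matrix.
\<close>

definition hermite_form ::
    "('n::finite) ordered_cone \<Rightarrow> (nat \<Rightarrow> int ^ 'n) \<Rightarrow> (nat \<Rightarrow> nat \<Rightarrow> int) \<Rightarrow> bool" where
  "hermite_form \<alpha> e a \<longleftrightarrow>
     (let k = length (edges \<alpha>) in
        zbasis k e (cone_lattice \<alpha>) \<and>
        (\<forall>i\<in>{1..k}. edge \<alpha> i = (\<Sum>j=1..i. a j i *s e j)) \<and>
        (\<forall>i\<in>{1..k}. a i i > 0) \<and>
        (\<forall>i\<in>{1..k}. \<forall>j\<in>{1..<i}. 0 \<le> a j i \<and> a j i < a i i) \<and>
        (\<forall>i j. \<not> (1 \<le> j \<and> j \<le> i \<and> i \<le> k) \<longrightarrow> a j i = 0))"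

definition IARCTAN :: "('n::finite) ordered_cone \<Rightarrow> nat \<Rightarrow> nat \<Rightarrow> int" where
  "IARCTAN \<alpha> = (THE a. \<exists>e. hermite_form \<alpha> e a)"

text \<open>\<open>lsin_at i \<alpha>\<close> is the \<open>i\<close>-th integer sine and \<open>lcos j i \<alpha>\<close> the \<open>(j, i)\<close>-th integer cosine
  (for \<open>j < i\<close>) of \<open>\<alpha>\<close>; \<open>lsin \<alpha>\<close> is the integer sine of the whole cone.\<close>

definition lsin_at :: "nat \<Rightarrow> ('n::finite) ordered_cone \<Rightarrow> int" where
  "lsin_at i \<alpha> = IARCTAN \<alpha> i i"

definition lcos :: "nat \<Rightarrow> nat \<Rightarrow> ('n::finite) ordered_cone \<Rightarrow> int" where
  "lcos j i \<alpha> = IARCTAN \<alpha> j i"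

definition lattice_index :: "(int ^ 'n) set \<Rightarrow> (int ^ 'n) set \<Rightarrow> nat" where
  "lattice_index L M = card (L // {(x, y). x \<in> L \<and> y \<in> L \<and> x - y \<in> M})"

definition lsin :: "('n::finite) ordered_cone \<Rightarrow> nat" where
  "lsin \<beta> = lattice_index (cone_lattice \<beta>) (int_vec.span (set (edges \<beta>)))"

text \<open>Faces are taken with every ordering of their edge vectors; \<open>lsin\<close> does not depend on it.\<close>

definition facet :: "('n::finite) ordered_cone \<Rightarrow> 'n ordered_cone \<Rightarrow> bool" where
  "facet \<beta> \<alpha> \<longleftrightarrow>
     vertex \<beta> = vertex \<alpha> \<and> distinct (edges \<beta>) \<and>
     set (edges \<beta>) \<subseteq> set (edges \<alpha>) \<and> length (edges \<beta>) + 1 = length (edges \<alpha>)"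

definition simple_cone :: "('n::finite) ordered_cone \<Rightarrow> bool" where
  "simple_cone \<alpha> \<longleftrightarrow> (\<forall>\<beta>. facet \<beta> \<alpha> \<longrightarrow> lsin \<beta> = 1)"

text \<open>The \<open>s\<close>-transpose \<open>\<alpha>\<^sub>s\<close>, with edge vectors \<open>(v\<^bsub>s(1)\<^esub>, \<dots>, v\<^bsub>s(k)\<^esub>)\<close>.\<close>

definition cone_transpose :: "(nat \<Rightarrow> nat) \<Rightarrow> ('n::finite) ordered_cone \<Rightarrow> 'n ordered_cone" where
  "cone_transpose s \<alpha> =
     \<alpha>\<lparr>edges := map (\<lambda>i. edge \<alpha> (s i)) [1..<Suc (length (edges \<alpha>))]\<rparr>"

end

theory Submission
  imports Defs
begin

text \<open>
  Simplicity makes \<open>v\<^sub>1, \<dots>, v\<^bsub>k-1\<^esub>\<close> part of a basis \<open>v\<^sub>1, \<dots>, v\<^bsub>k-1\<^esub>, f\<close> of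
  \<open>\<Gamma>\<close> with \<open>v\<^sub>k = \<Sum> b\<^sub>m v\<^sub>m + N f\<close> and \<open>N > 0\<close>; changing \<open>f\<close> reduces the \<open>b\<^sub>m\<close> modulo \<open>N\<close>,
  so \<open>N\<close> and \<open>b\<^sub>m mod N\<close> are the last column of the Hermite normal form. The number \<open>N\<close> is the
  exponent of \<open>\<Gamma> / \<Sum> \<int> v\<^sub>m\<close> and hence does not depend on the order of the edges. For \<open>j < k\<close> the
  same \<open>f\<close> serves the transposed cone. For \<open>j = k\<close> the transposed cone yields a relation
  \<open>v\<^sub>i - b'\<^sub>i v\<^sub>k - \<Sum> b'\<^sub>x v\<^sub>x \<in> N \<Gamma>\<close>, and \<open>\<Sum> c\<^sub>m v\<^sub>m \<in> N \<Gamma>\<close> forces \<open>N\<close> to divide every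
  \<open>c\<^sub>x + c\<^sub>k b\<^sub>x\<close>.
\<close>

text \<open>Keeps the lower bound 1 of ranges such as \<open>{1..k}\<close> and
  \<open>{1..<k}\<close> from turning into \<open>Suc 0\<close>.\<close>

declare One_nat_def [simp del]

section \<open>Integer vectors, their real embedding and indexed coefficient families\<close>

lemma of_int_vec_0 [simp]: "of_int_vec 0 = 0"
  by (simp add: of_int_vec_def vec_eq_iff)

lemma of_int_vec_add: "of_int_vec (x + y) = of_int_vec x + of_int_vec y"
  by (simp add: of_int_vec_def vec_eq_iff)

lemma of_int_vec_diff: "of_int_vec (x - y) = of_int_vec x - of_int_vec y"
  by (simp add: of_int_vec_def vec_eq_iff)

lemma of_int_vec_scale: "of_int_vec (c *s x) = of_int c *\<^sub>R of_int_vec x"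
  by (simp add: of_int_vec_def vec_eq_iff)

lemma of_int_vec_sum: "of_int_vec (\<Sum>m\<in>I. f m) = (\<Sum>m\<in>I. of_int_vec (f m))"
  by (induction I rule: infinite_finite_induct) (simp_all add: of_int_vec_add)

lemma of_int_vec_lincomb:
  "of_int_vec (\<Sum>m\<in>I. c m *s x m) = (\<Sum>m\<in>I. of_int (c m) *\<^sub>R of_int_vec (x m))"
  by (simp add: of_int_vec_sum of_int_vec_scale)

lemma of_int_vec_eq_iff [simp]: "of_int_vec x = of_int_vec y \<longleftrightarrow> x = y"
  by (simp add: of_int_vec_def vec_eq_iff)

text \<open>Such a vector is a function from a finite type into a finite interval. This is the
  source of finiteness for the choice of a lattice vector of least height.\<close>

lemma finite_bounded_int_vec: "finite {x :: int ^ 'n::finite. \<forall>i. \<bar>x $ i\<bar> \<le> B}"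
proof -
  have "{x :: int ^ 'n. \<forall>i. \<bar>x $ i\<bar> \<le> B} \<subseteq> vec_lambda ` (\<Pi>\<^sub>E i\<in>UNIV. {- B..B})"
  proof
    fix x :: "int ^ 'n" assume "x \<in> {x. \<forall>i. \<bar>x $ i\<bar> \<le> B}"
    then have "vec_nth x \<in> (\<Pi>\<^sub>E i\<in>UNIV. {- B..B})"
      by (auto simp: abs_le_iff minus_le_iff)
    then show "x \<in> vec_lambda ` (\<Pi>\<^sub>E i\<in>UNIV. {- B..B})"
      by (metis image_eqI vec_nth_inverse)
  qed
  then show ?thesis
    by (rule finite_subset) (intro finite_imageI finite_PiE; simp)
qed

text \<open>Coefficients attached to vectors are pulled back along \<open>e\<close>, so that later
  coordinates can be addressed by edge number.\<close>

lemma in_span_image_iff: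
  assumes "finite I" "inj_on e I"
  shows "x \<in> int_vec.span (e ` I) \<longleftrightarrow> (\<exists>c. x = (\<Sum>m\<in>I. c m *s e m))"
proof
  assume "x \<in> int_vec.span (e ` I)"
  then obtain u where "x = (\<Sum>v\<in>e ` I. u v *s v)"
    using assms by (auto simp: int_vec.span_finite)
  then show "\<exists>c. x = (\<Sum>m\<in>I. c m *s e m)"
    using assms by (auto simp: sum.reindex intro!: exI[of _ "\<lambda>m. u (e m)"])
next
  assume "\<exists>c. x = (\<Sum>m\<in>I. c m *s e m)"
  then show "x \<in> int_vec.span (e ` I)"
    by (auto intro: int_vec.span_sum int_vec.span_scale int_vec.span_base)
qed

lemma in_real_span_image_iff:
  fixes e :: "'i \<Rightarrow> 'a::real_vector"
  assumes "finite I" "inj_on e I"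
  shows "x \<in> span (e ` I) \<longleftrightarrow> (\<exists>r. x = (\<Sum>m\<in>I. r m *\<^sub>R e m))"
proof
  assume "x \<in> span (e ` I)"
  then obtain u where "x = (\<Sum>v\<in>e ` I. u v *\<^sub>R v)"
    using assms by (auto simp: span_finite)
  then show "\<exists>r. x = (\<Sum>m\<in>I. r m *\<^sub>R e m)"
    using assms by (auto simp: sum.reindex intro!: exI[of _ "\<lambda>m. u (e m)"])
next
  assume "\<exists>r. x = (\<Sum>m\<in>I. r m *\<^sub>R e m)"
  then show "x \<in> span (e ` I)"
    by (auto intro: span_sum span_scale span_base)
qed

text \<open>The criterion on indexed coefficients also yields injectivity: if
  \<open>e p = e q\<close> with \<open>p\<close> and \<open>q\<close> distinct, the difference of
  the two indicator functions is a nontrivial relation.\<close>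

lemma independent_familyI:
  fixes e :: "'i \<Rightarrow> int ^ 'n::finite"
  assumes I: "finite I"
    and indep: "\<And>c m. (\<Sum>m\<in>I. c m *s e m) = 0 \<Longrightarrow> m \<in> I \<Longrightarrow> c m = 0"
  shows "inj_on e I" and "int_vec.independent (e ` I)"
proof -
  show inj: "inj_on e I"
  proof (rule inj_onI, rule ccontr)
    fix p q assume pq: "p \<in> I" "q \<in> I" "e p = e q" "p \<noteq> q"
    define c :: "'i \<Rightarrow> int" where "c m = (if m = p then 1 else 0) - (if m = q then 1 else 0)" for m
    have "(\<Sum>m\<in>I. c m *s e m) =
        (\<Sum>m\<in>I. (if m = p then e m else 0) - (if m = q then e m else 0))"
      by (rule sum.cong) (auto simp: c_def)
    also have "\<dots> = 0"
      using I pq by (simp add: sum_subtractf)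
    finally have "c p = 0"
      using indep pq by blast
    then show False using pq by (simp add: c_def)
  qed
  show "int_vec.independent (e ` I)"
    unfolding int_vec.dependent_finite[OF finite_imageI[OF I]]
    using indep[of "\<lambda>m. u (e m)" for u] by (auto simp: sum.reindex[OF inj])
qed

lemma lattice_index_eq_1D:
  assumes "lattice_index L M = 1" "int_vec.subspace M" "0 \<in> L" "x \<in> L"
  shows "x \<in> M"
proof -
  define R where "R = {(x, y). x \<in> L \<and> y \<in> L \<and> x - y \<in> M}"
  have "card (L // R) = 1"
    using assms(1) by (simp add: lattice_index_def R_def)
  then obtain C where "L // R = {C}"
    by (rule card_1_singletonE)
  then have "R `` {x} = R `` {0}"
    using assms(3,4) by (metis quotientI singletonD)
  moreover have "x \<in> R `` {x}"
    using assms int_vec.subspace_0 by (auto simp: R_def)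
  \<comment> \<open>With a single class, \<open>x\<close> is related to 0; the relation holds of the
    pair \<open>(0, x)\<close> and so speaks of \<open>0 - x\<close>.\<close>
  ultimately have "- x \<in> M" by (auto simp: R_def)
  then show ?thesis using int_vec.subspace_neg[OF assms(2), of "- x"] by simp
qed

section \<open>Edges and lattice of a rational cone\<close>

lemma set_edges:
  assumes "length (edges \<alpha>) = k"
  shows "set (edges \<alpha>) = edge \<alpha> ` {1..k}"
proof
  show "edge \<alpha> ` {1..k} \<subseteq> set (edges \<alpha>)"
    using assms by (auto simp: edge_def)
  show "set (edges \<alpha>) \<subseteq> edge \<alpha> ` {1..k}"
  proof
    fix x assume "x \<in> set (edges \<alpha>)"
    then obtain m where "m < k" "x = edges \<alpha> ! m"
      using assms by (metis in_set_conv_nth)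
    then show "x \<in> edge \<alpha> ` {1..k}"
      \<comment> \<open>\<open>edge\<close> subtracts 1 from its argument, so list position
        \<open>m\<close> belongs to edge number \<open>Suc m\<close>.\<close>
      by (intro image_eqI[of _ _ "Suc m"]) (auto simp: edge_def)
  qed
qed

lemma set_butlast_edges:
  assumes "length (edges \<alpha>) = k"
  shows "set (butlast (edges \<alpha>)) = edge \<alpha> ` {1..<k}"
proof (cases "k = 0")
  case False
  let ?\<beta> = "\<alpha>\<lparr>edges := butlast (edges \<alpha>)\<rparr>"
  have "set (butlast (edges \<alpha>)) = edge ?\<beta> ` {1..k - 1}"
    using set_edges[of ?\<beta> "k - 1"] assms by simp
  also have "\<dots> = edge \<alpha> ` {1..<k}"
    using assms False by (intro image_cong) (auto simp: edge_def nth_butlast)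
  finally show ?thesis .
qed (use assms in simp)

lemma inj_on_edge:
  assumes "rational_cone k \<alpha>"
  shows "inj_on (edge \<alpha>) {1..k}"
proof (rule inj_onI)
  fix p q assume pq: "p \<in> {1..k}" "q \<in> {1..k}" "edge \<alpha> p = edge \<alpha> q"
  have "length (edges \<alpha>) = k" "distinct (edges \<alpha>)"
    using assms by (simp_all add: rational_cone_def)
  moreover have "p - 1 < k" "q - 1 < k"
    using pq by auto
  ultimately have "p - 1 = q - 1"
    using pq(3) by (simp add: edge_def nth_eq_iff_index_eq)
  then show "p = q" using pq by auto
qed

lemma inj_on_of_int_vec_edge:
  assumes "rational_cone k \<alpha>"
  shows "inj_on (\<lambda>m. of_int_vec (edge \<alpha> m)) {1..k}"
  using inj_on_edge[OF assms] unfolding inj_on_def of_int_vec_eq_iff .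

lemma edges_independent_real:
  assumes "rational_cone k \<alpha>"
    and "(\<Sum>m\<in>{1..k}. r m *\<^sub>R of_int_vec (edge \<alpha> m)) = 0" "m \<in> {1..k}"
  shows "r m = 0"
proof -
  let ?e = "\<lambda>m. of_int_vec (edge \<alpha> m)"
  have inj: "inj_on ?e {1..k}"
    by (rule inj_on_of_int_vec_edge[OF assms(1)])
  have "length (edges \<alpha>) = k"
    using assms(1) by (simp add: rational_cone_def)
  then have ind: "independent (?e ` {1..k})"
    using assms(1) set_edges[of \<alpha> k] by (simp add: rational_cone_def image_image)
  \<comment> \<open>Independence of the edge set asks for coefficients on vectors; the inverse of
    the injective numbering carries \<open>r\<close> over to them.\<close>
  define u where "u w = r (the_inv_into {1..k} ?e w)" for w
  have "(\<Sum>w\<in>?e ` {1..k}. u w *\<^sub>R w) = 0"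
    using assms(2) by (simp add: sum.reindex[OF inj] u_def the_inv_into_f_f[OF inj])
  then have "u (?e m) = 0"
    using independentD[OF ind, of "?e ` {1..k}" u "?e m"] assms(3) by auto
  then show ?thesis
    using assms(3) by (simp add: u_def the_inv_into_f_f[OF inj])
qed

lemma edges_independent_int:
  assumes "rational_cone k \<alpha>"
    and "(\<Sum>m\<in>{1..k}. c m *s edge \<alpha> m) = 0" "m \<in> {1..k}"
  shows "c m = 0"
proof -
  have "(\<Sum>m\<in>{1..k}. of_int (c m) *\<^sub>R of_int_vec (edge \<alpha> m)) = 0"
    using assms(2) of_int_vec_lincomb[of c "edge \<alpha>" "{1..k}"] by simp
  then have "real_of_int (c m) = 0"
    using edges_independent_real[OF assms(1), of "\<lambda>m. of_int (c m)"] assms(3) by blast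
  then show ?thesis by simp
qed

lemma in_cone_lattice_iff:
  assumes "rational_cone k \<alpha>"
  shows "x \<in> cone_lattice \<alpha> \<longleftrightarrow>
    (\<exists>r. of_int_vec x = (\<Sum>m\<in>{1..k}. r m *\<^sub>R of_int_vec (edge \<alpha> m)))"
proof -
  have "length (edges \<alpha>) = k"
    using assms by (simp add: rational_cone_def)
  then have "of_int_vec ` set (edges \<alpha>) = (\<lambda>m. of_int_vec (edge \<alpha> m)) ` {1..k}"
    using set_edges[of \<alpha> k] by (simp add: image_image)
  then show ?thesis
    using in_real_span_image_iff[OF _ inj_on_of_int_vec_edge[OF assms], of "of_int_vec x"]
    by (simp add: cone_lattice_def)
qed

lemma subspace_cone_lattice: "int_vec.subspace (cone_lattice \<alpha>)"
  unfolding int_vec.subspace_def cone_lattice_def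
  by (simp add: of_int_vec_add of_int_vec_scale span_0 span_add span_scale)

lemma edge_in_cone_lattice:
  assumes "rational_cone k \<alpha>" "m \<in> {1..k}"
  shows "edge \<alpha> m \<in> cone_lattice \<alpha>"
proof -
  have "edge \<alpha> m \<in> set (edges \<alpha>)"
    using assms set_edges[of \<alpha> k] by (simp add: rational_cone_def)
  then show ?thesis
    by (simp add: cone_lattice_def span_base)
qed

text \<open>Simplicity enters here through the facet that omits the last edge: its index is 1, so
  its edges already generate every integer vector in their real span.\<close>

lemma simple_cone_facet_lattice:
  assumes "rational_cone k \<alpha>" "simple_cone \<alpha>" "1 \<le> k"
    and x: "of_int_vec x = (\<Sum>m\<in>{1..<k}. r m *\<^sub>R of_int_vec (edge \<alpha> m))"
  obtains c where "x = (\<Sum>m\<in>{1..<k}. c m *s edge \<alpha> m)"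
proof -
  let ?\<beta> = "\<alpha>\<lparr>edges := butlast (edges \<alpha>)\<rparr>"
  have len: "length (edges \<alpha>) = k" and dist: "distinct (edges \<alpha>)"
    using assms(1) by (simp_all add: rational_cone_def)
  have "facet ?\<beta> \<alpha>"
    using len dist assms(3)
    by (auto simp: facet_def distinct_butlast dest: in_set_butlastD)
  then have "lattice_index (cone_lattice ?\<beta>) (int_vec.span (edge \<alpha> ` {1..<k})) = 1"
    using assms(2) set_butlast_edges[OF len] by (auto simp: simple_cone_def lsin_def)
  moreover have "(\<Sum>m\<in>{1..<k}. r m *\<^sub>R of_int_vec (edge \<alpha> m)) \<in>
      span (of_int_vec ` edge \<alpha> ` {1..<k})"
    by (intro span_sum span_scale span_base) auto
  with x have "x \<in> cone_lattice ?\<beta>"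
    using set_butlast_edges[OF len] by (simp add: cone_lattice_def)
  ultimately have "x \<in> int_vec.span (edge \<alpha> ` {1..<k})"
    using lattice_index_eq_1D[OF _ int_vec.subspace_span] int_vec.subspace_0[OF subspace_cone_lattice]
    by blast
  moreover have "inj_on (edge \<alpha>) {1..<k}"
    by (rule inj_on_subset[OF inj_on_edge[OF assms(1)]]) auto
  ultimately show ?thesis
    using that by (auto simp: in_span_image_iff)
qed

subsection \<open>Bases adapted to the last edge\<close>

text \<open>The first \<open>k - 1\<close> edges together with \<open>f\<close> form a basis of the
  lattice; their independence is a consequence, proved in \<open>adapted_basis_independent\<close>.
  The entries \<open>b\<close> may be unreduced: reduction modulo \<open>N\<close> is a change of
  \<open>f\<close>.\<close>

definition adapted_basis ::
    "nat \<Rightarrow> ('n::finite) ordered_cone \<Rightarrow> int ^ 'n \<Rightarrow> int \<Rightarrow> (nat \<Rightarrow> int) \<Rightarrow> bool" where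
  "adapted_basis k \<alpha> f N b \<longleftrightarrow>
     N > 0 \<and>
     cone_lattice \<alpha> = {x. \<exists>c d. x = (\<Sum>m\<in>{1..<k}. c m *s edge \<alpha> m) + d *s f} \<and>
     edge \<alpha> k = (\<Sum>m\<in>{1..<k}. b m *s edge \<alpha> m) + N *s f"

lemma sum_split_last:
  assumes "1 \<le> (k::nat)"
  shows "(\<Sum>m\<in>{1..k}. g m) = (\<Sum>m\<in>{1..<k}. g m) + (g k :: 'a::comm_monoid_add)"
  by (subst add.commute) (rule sum.last_plus[OF assms])

text \<open>Coefficients between 0 and 1 bound each coordinate of \<open>x\<close> by the total of
  the absolute values of all edge entries, a bound that depends neither on \<open>x\<close> nor on
  the coordinate.\<close>

lemma finite_lattice_box:
  assumes "rational_cone k \<alpha>"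
  shows "finite {x. \<exists>r. of_int_vec x = (\<Sum>m\<in>{1..k}. r m *\<^sub>R of_int_vec (edge \<alpha> m)) \<and>
                        (\<forall>m\<in>{1..k}. 0 \<le> r m \<and> r m \<le> 1)}" (is "finite ?P")
proof -
  define B where "B = (\<Sum>m\<in>{1..k}. \<Sum>i\<in>UNIV. \<bar>edge \<alpha> m $ i\<bar>)"
  have "?P \<subseteq> {x. \<forall>i. \<bar>x $ i\<bar> \<le> B}"
  proof (clarify)
    fix x r i
    assume x: "of_int_vec x = (\<Sum>m\<in>{1..k}. r m *\<^sub>R of_int_vec (edge \<alpha> m))"
      and r: "\<forall>m\<in>{1..k}. 0 \<le> r m \<and> r m \<le> 1"
    have "real_of_int (x $ i) = (\<Sum>m\<in>{1..k}. r m * of_int (edge \<alpha> m $ i))"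
      using arg_cong[OF x, of "\<lambda>w. w $ i"] by (simp add: of_int_vec_def)
    then have "\<bar>real_of_int (x $ i)\<bar> \<le> (\<Sum>m\<in>{1..k}. \<bar>r m * of_int (edge \<alpha> m $ i)\<bar>)"
      by (simp add: sum_abs)
    also have "\<dots> \<le> (\<Sum>m\<in>{1..k}. of_int (\<Sum>i\<in>UNIV. \<bar>edge \<alpha> m $ i\<bar>))"
    proof (rule sum_mono)
      fix m assume m: "m \<in> {1..k}"
      have "\<bar>r m * of_int (edge \<alpha> m $ i)\<bar> \<le> 1 * \<bar>real_of_int (edge \<alpha> m $ i)\<bar>"
        using r m unfolding abs_mult by (intro mult_right_mono) auto
      also have "\<dots> \<le> of_int (\<Sum>i\<in>UNIV. \<bar>edge \<alpha> m $ i\<bar>)"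
        using member_le_sum[of i UNIV "\<lambda>i. \<bar>edge \<alpha> m $ i\<bar>"]
        by (simp flip: of_int_abs del: of_int_sum)
      finally show "\<bar>r m * of_int (edge \<alpha> m $ i)\<bar> \<le> of_int (\<Sum>i\<in>UNIV. \<bar>edge \<alpha> m $ i\<bar>)" .
    qed
    finally have "\<bar>real_of_int (x $ i)\<bar> \<le> of_int B"
      by (simp add: B_def)
    then show "\<bar>x $ i\<bar> \<le> B"
      by (simp flip: of_int_abs)
  qed
  then show ?thesis
    by (rule finite_subset) (rule finite_bounded_int_vec)
qed

text \<open>The last basis vector is a lattice vector of least positive \<open>k\<close>-th real coordinate; it
  exists because subtracting integer multiples of the first \<open>k - 1\<close> edges brings every candidate
  into a bounded box.\<close>

lemma adapted_basis_exists:
  fixes \<alpha> :: "('n::finite) ordered_cone"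
  assumes rat: "rational_cone k \<alpha>" and simple: "simple_cone \<alpha>" and k: "1 \<le> k"
  obtains f N b where "adapted_basis k \<alpha> f N b"
proof -
  let ?V = "\<lambda>m. of_int_vec (edge \<alpha> m)"
  define coords where
    "coords x r \<longleftrightarrow> of_int_vec x = (\<Sum>m\<in>{1..k}. r m *\<^sub>R ?V m)" for x r
  \<comment> \<open>Each candidate is stored with its height \<open>t\<close>, the coefficient of
    the last edge. The condition \<open>0 < t\<close> excludes the span of the first
    \<open>k - 1\<close> edges.\<close>
  define P where "P = {(x, t). \<exists>r. coords x r \<and> r k = t \<and>
    (\<forall>m\<in>{1..k}. 0 \<le> r m \<and> r m \<le> 1) \<and> 0 < t}"
  have coords_unique: "r m = s m" if "coords x r" "coords x s" "m \<in> {1..k}" for x r s m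
  proof -
    have "(\<Sum>m\<in>{1..k}. (r m - s m) *\<^sub>R ?V m) = 0"
      using that by (simp add: coords_def scaleR_diff_left sum_subtractf)
    then show ?thesis
      using edges_independent_real[OF rat, of "\<lambda>m. r m - s m" m] that(3) by simp
  qed
  have coords_diff: "coords (x - q *s y) (\<lambda>m. r m - of_int q * s m)"
    if "coords x r" "coords y s" for x y r s q
    using that
    by (simp add: coords_def of_int_vec_diff of_int_vec_scale scaleR_diff_left sum_subtractf
        scaleR_sum_right)
  \<comment> \<open>The value 0 at \<open>k\<close> means that subtracting such a combination leaves
    the height unchanged.\<close>
  have coords_edges: "coords (\<Sum>m\<in>{1..<k}. c m *s edge \<alpha> m) (\<lambda>m. if m < k then of_int (c m) else 0)" for c
    using k by (simp add: coords_def of_int_vec_lincomb sum_split_last)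
  have coords_edge: "coords (edge \<alpha> k) (\<lambda>m. if m = k then 1 else 0)"
    using k by (simp add: coords_def sum_split_last)
  have facet: "\<exists>c. x = (\<Sum>m\<in>{1..<k}. c m *s edge \<alpha> m)" if "coords x r" "r k = 0" for x r
  proof -
    have "of_int_vec x = (\<Sum>m\<in>{1..<k}. r m *\<^sub>R ?V m)"
      using that by (simp add: coords_def sum_split_last[OF k])
    then show ?thesis
      by (rule simple_cone_facet_lattice[OF rat simple k]) blast
  qed
  have "finite P"
  proof (rule finite_imageD)
    show "finite (fst ` P)"
      by (rule finite_subset[OF _ finite_lattice_box[OF rat]])
        (auto simp: P_def coords_def)
    show "inj_on fst P"
      using coords_unique[of _ _ _ k] k by (auto simp: P_def intro!: inj_onI)
  qed
  moreover have "(edge \<alpha> k, 1) \<in> P"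
    using coords_edge by (auto simp: P_def)
  ultimately have fin: "finite (snd ` P)" and ne: "snd ` P \<noteq> {}"
    by auto
  define t where "t = Min (snd ` P)"
  from Min_in[OF fin ne] obtain f where ft: "(f, t) \<in> P"
    by (auto simp: t_def)
  have min: "t \<le> s" if "(x, s) \<in> P" for x s
    unfolding t_def using that by (intro Min_le[OF fin]) force
  from ft obtain fr where fr: "coords f fr" "fr k = t" "0 < t" "t \<le> 1"
    using k by (auto simp: P_def)
  have decomp: "\<exists>c d. x = (\<Sum>m\<in>{1..<k}. c m *s edge \<alpha> m) + d *s f"
    if x: "x \<in> cone_lattice \<alpha>" for x
  proof -
    obtain r where r: "coords x r"
      using x in_cone_lattice_iff[OF rat] by (auto simp: coords_def)
    \<comment> \<open>Division with remainder of the height of \<open>x\<close> by \<open>t\<close>: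
      the remainder \<open>y\<close> has height in \<open>[0, t)\<close>, and minimality of
      \<open>t\<close> will force it to be 0.\<close>
    define q where "q = \<lfloor>r k / t\<rfloor>"
    define y where "y = x - q *s f"
    define s where "s m = r m - of_int q * fr m" for m
    have s: "coords y s"
      unfolding y_def s_def by (rule coords_diff[OF r fr(1)])
    have "of_int q \<le> r k / t" "r k / t < of_int q + 1"
      by (simp_all add: q_def floor_correct)
    then have sk: "0 \<le> s k" "s k < t"
      using fr by (simp_all add: s_def field_simps)
    have "s k = 0"
    proof (rule ccontr)
      assume "s k \<noteq> 0"
      \<comment> \<open>Removing the integer parts of the first \<open>k - 1\<close> coordinates
        moves \<open>y\<close> into the box without changing its height, which is below
        \<open>t\<close> and hence at most 1. The factor \<open>1\<close> only matches the shape of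
        \<open>coords_diff\<close>.\<close>
      define z where "z = y - 1 *s (\<Sum>m\<in>{1..<k}. \<lfloor>s m\<rfloor> *s edge \<alpha> m)"
      define u where "u m = s m - of_int 1 * (if m < k then of_int \<lfloor>s m\<rfloor> else 0)" for m
      have "coords z u"
        unfolding z_def u_def by (rule coords_diff[OF s coords_edges])
      moreover have "0 \<le> u m \<and> u m \<le> 1" if "m \<in> {1..k}" for m
        using that sk fr by (cases "m = k") (auto simp: u_def, linarith+)
      ultimately have "(z, s k) \<in> P"
        using sk \<open>s k \<noteq> 0\<close> by (auto simp: P_def u_def intro!: exI[of _ u])
      then show False
        using min sk by fastforce
    qed
    with facet[OF s] obtain c where "y = (\<Sum>m\<in>{1..<k}. c m *s edge \<alpha> m)"
      by blast
    then show ?thesis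
      by (intro exI[of _ c] exI[of _ q]) (simp add: y_def algebra_simps)
  qed
  have f: "f \<in> cone_lattice \<alpha>"
    using fr(1) in_cone_lattice_iff[OF rat] by (auto simp: coords_def)
  obtain b N where bN: "edge \<alpha> k = (\<Sum>m\<in>{1..<k}. b m *s edge \<alpha> m) + N *s f"
    using decomp[OF edge_in_cone_lattice[OF rat]] k by fastforce
  \<comment> \<open>The height of \<open>N *s f\<close> is computed twice: as 1 from this
    expression, and as \<open>N\<close> times \<open>t\<close> from the coordinates of
    \<open>f\<close>. Since \<open>t\<close> is positive, so is \<open>N\<close>.\<close>
  then have "N *s f = edge \<alpha> k - 1 *s (\<Sum>m\<in>{1..<k}. b m *s edge \<alpha> m)"
    by simp
  with coords_diff[OF coords_edge coords_edges, of 1 b]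
  have "coords (N *s f) (\<lambda>m. (if m = k then 1 else 0) - of_int 1 * (if m < k then of_int (b m) else 0))"
    by simp
  moreover have "coords (N *s f) (\<lambda>m. of_int N * fr m)"
    using fr(1) by (simp add: coords_def of_int_vec_scale scaleR_sum_right)
  ultimately have "of_int N * t = 1"
    using coords_unique[of "N *s f" _ _ k] fr(2) k by fastforce
  then have "N > 0"
    using fr(3) by (metis of_int_0_less_iff zero_less_mult_pos2 zero_less_one)
  moreover have "(\<Sum>m\<in>{1..<k}. c m *s edge \<alpha> m) + d *s f \<in> cone_lattice \<alpha>" for c d
    using f subspace_cone_lattice[of \<alpha>] edge_in_cone_lattice[OF rat]
    by (auto intro!: int_vec.subspace_add int_vec.subspace_sum int_vec.subspace_scale)
  ultimately have "adapted_basis k \<alpha> f N b"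
    using bN decomp by (auto simp: adapted_basis_def)
  then show ?thesis by (rule that)
qed

text \<open>Multiply the relation by \<open>N\<close> and eliminate \<open>N *s f\<close> through
  the formula for the last edge. The result is a relation among the edges with coefficients
  \<open>N * c m - d * b m\<close> and \<open>d\<close>, all of which vanish; \<open>N > 0\<close>
  then gives \<open>c m = 0\<close>.\<close>

lemma adapted_basis_independent:
  assumes rat: "rational_cone k \<alpha>" and k: "1 \<le> k" and ad: "adapted_basis k \<alpha> f N b"
    and eq: "(\<Sum>m\<in>{1..<k}. c m *s edge \<alpha> m) + d *s f = 0"
  shows "d = 0" and "\<And>m. m \<in> {1..<k} \<Longrightarrow> c m = 0"
proof -
  have N: "N > 0" and vk: "edge \<alpha> k = (\<Sum>m\<in>{1..<k}. b m *s edge \<alpha> m) + N *s f"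
    using ad by (simp_all add: adapted_basis_def)
  define u where "u m = (if m < k then N * c m - d * b m else d)" for m
  have "(\<Sum>m\<in>{1..<k}. u m *s edge \<alpha> m) =
      (\<Sum>m\<in>{1..<k}. N *s (c m *s edge \<alpha> m) - d *s (b m *s edge \<alpha> m))"
    by (intro sum.cong) (simp_all add: u_def int_vec.scale_left_diff_distrib)
  also have "\<dots> = N *s (\<Sum>m\<in>{1..<k}. c m *s edge \<alpha> m) - d *s (\<Sum>m\<in>{1..<k}. b m *s edge \<alpha> m)"
    by (simp only: sum_subtractf int_vec.scale_sum_right)
  finally have "(\<Sum>m\<in>{1..k}. u m *s edge \<alpha> m) =
      N *s (\<Sum>m\<in>{1..<k}. c m *s edge \<alpha> m) + d *s (N *s f)"
    unfolding sum_split_last[OF k] by (simp add: u_def vk int_vec.scale_right_distrib)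
  also have "\<dots> = N *s ((\<Sum>m\<in>{1..<k}. c m *s edge \<alpha> m) + d *s f)"
    by (simp add: int_vec.scale_right_distrib mult.commute)
  finally have u0: "u m = 0" if "m \<in> {1..k}" for m
    using edges_independent_int[OF rat _ that, of u] eq by simp
  show d: "d = 0"
    using u0[of k] k by (simp add: u_def)
  show "c m = 0" if "m \<in> {1..<k}" for m
    using u0[of m] that d N by (simp add: u_def)
qed

lemma adapted_basis_eqD:
  assumes rat: "rational_cone k \<alpha>" and k: "1 \<le> k" and ad: "adapted_basis k \<alpha> f N b"
    and eq: "(\<Sum>m\<in>{1..<k}. c m *s edge \<alpha> m) + d *s f = (\<Sum>m\<in>{1..<k}. c' m *s edge \<alpha> m) + d' *s f"
  shows "d = d'" and "\<And>m. m \<in> {1..<k} \<Longrightarrow> c m = c' m"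
proof -
  have "(\<Sum>m\<in>{1..<k}. (c m - c' m) *s edge \<alpha> m) + (d - d') *s f =
      ((\<Sum>m\<in>{1..<k}. c m *s edge \<alpha> m) + d *s f) - ((\<Sum>m\<in>{1..<k}. c' m *s edge \<alpha> m) + d' *s f)"
    by (simp add: int_vec.scale_left_diff_distrib sum_subtractf)
  then have "(\<Sum>m\<in>{1..<k}. (c m - c' m) *s edge \<alpha> m) + (d - d') *s f = 0"
    unfolding eq by simp
  from adapted_basis_independent[OF rat k ad this]
  show "d = d'" "\<And>m. m \<in> {1..<k} \<Longrightarrow> c m = c' m"
    by simp_all
qed

lemma adapted_basis_shift:
  assumes "(\<Sum>m\<in>{1..<k}. g m *s edge \<alpha> m) + f = f'"
  shows "(\<Sum>m\<in>{1..<k}. c m *s edge \<alpha> m) + d *s f' =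
    (\<Sum>m\<in>{1..<k}. (c m + d * g m) *s edge \<alpha> m) + d *s f"
  unfolding assms[symmetric]
  by (simp add: int_vec.scale_left_distrib int_vec.scale_right_distrib sum.distrib
      int_vec.scale_sum_right)

lemma adapted_basis_reduce:
  assumes ad: "adapted_basis k \<alpha> f N b"
  obtains f' where "adapted_basis k \<alpha> f' N (\<lambda>m. b m mod N)"
proof -
  \<comment> \<open>The quotients are absorbed into the new basis vector: \<open>N *s f'\<close>
    contains \<open>N * (b m div N)\<close> copies of edge \<open>m\<close>, so only remainders stay
    outside.\<close>
  define g where "g m = b m div N" for m
  define f' where "f' = (\<Sum>m\<in>{1..<k}. g m *s edge \<alpha> m) + f"
  note shift = adapted_basis_shift[OF f'_def[symmetric]]
  have "{x. \<exists>c d. x = (\<Sum>m\<in>{1..<k}. c m *s edge \<alpha> m) + d *s f} =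
        {x. \<exists>c d. x = (\<Sum>m\<in>{1..<k}. c m *s edge \<alpha> m) + d *s f'}"
  proof (intro Collect_cong iffI)
    fix x
    assume "\<exists>c d. x = (\<Sum>m\<in>{1..<k}. c m *s edge \<alpha> m) + d *s f"
    then obtain c d where "x = (\<Sum>m\<in>{1..<k}. c m *s edge \<alpha> m) + d *s f"
      by blast
    \<comment> \<open>Replacing \<open>f\<close> by \<open>f'\<close> is a unimodular shear; its
      inverse has these integer coefficients.\<close>
    then have "x = (\<Sum>m\<in>{1..<k}. (c m - d * g m) *s edge \<alpha> m) + d *s f'"
      unfolding shift by simp
    then show "\<exists>c d. x = (\<Sum>m\<in>{1..<k}. c m *s edge \<alpha> m) + d *s f'"
      by (intro exI)
  next
    fix x
    assume "\<exists>c d. x = (\<Sum>m\<in>{1..<k}. c m *s edge \<alpha> m) + d *s f'"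
    then obtain c d where "x = (\<Sum>m\<in>{1..<k}. c m *s edge \<alpha> m) + d *s f'"
      by blast
    then show "\<exists>c d. x = (\<Sum>m\<in>{1..<k}. c m *s edge \<alpha> m) + d *s f"
      unfolding shift by (intro exI)
  qed
  moreover have "edge \<alpha> k = (\<Sum>m\<in>{1..<k}. (b m mod N) *s edge \<alpha> m) + N *s f'"
    using ad unfolding shift by (simp add: adapted_basis_def g_def)
  ultimately have "adapted_basis k \<alpha> f' N (\<lambda>m. b m mod N)"
    using ad by (simp add: adapted_basis_def)
  then show ?thesis by (rule that)
qed

subsection \<open>The Hermite normal form of a simple cone\<close>

text \<open>The identity matrix with last column replaced by \<open>b\<close> and \<open>N\<close>.
  The zeros outside the triangle follow the convention of \<open>hermite_form\<close>, so matrices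
  can be compared as functions.\<close>

definition adapted_matrix :: "nat \<Rightarrow> int \<Rightarrow> (nat \<Rightarrow> int) \<Rightarrow> nat \<Rightarrow> nat \<Rightarrow> int" where
  "adapted_matrix k N b j i =
     (if i = k then (if j = k then N else if j \<in> {1..<k} then b j else 0)
      else if j = i \<and> i \<in> {1..<k} then 1 else 0)"

text \<open>Existence half of the computation of \<open>IARCTAN\<close>: once \<open>b\<close> is
  reduced, the adapted basis itself witnesses the normal form.\<close>

lemma adapted_basis_hermite_form:
  assumes rat: "rational_cone k \<alpha>" and k: "1 \<le> k" and ad: "adapted_basis k \<alpha> f N b"
    and b: "\<And>m. m \<in> {1..<k} \<Longrightarrow> 0 \<le> b m \<and> b m < N"
  shows "hermite_form \<alpha> (\<lambda>m. if m < k then edge \<alpha> m else f) (adapted_matrix k N b)"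
proof -
  let ?e = "\<lambda>m. if m < k then edge \<alpha> m else f"
  let ?a = "adapted_matrix k N b"
  have len: "length (edges \<alpha>) = k" and N: "N > 0"
    and lat: "cone_lattice \<alpha> = {x. \<exists>c d. x = (\<Sum>m\<in>{1..<k}. c m *s edge \<alpha> m) + d *s f}"
    and vk: "edge \<alpha> k = (\<Sum>m\<in>{1..<k}. b m *s edge \<alpha> m) + N *s f"
    using rat ad by (simp_all add: rational_cone_def adapted_basis_def)
  have sum_e: "(\<Sum>m\<in>{1..k}. c m *s ?e m) = (\<Sum>m\<in>{1..<k}. c m *s edge \<alpha> m) + c k *s f" for c
    unfolding sum_split_last[OF k] by simp
  have indep: "c m = 0" if "(\<Sum>m\<in>{1..k}. c m *s ?e m) = 0" "m \<in> {1..k}" for c m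
    using adapted_basis_independent[OF rat k ad that(1)[unfolded sum_e]] that(2)
    by (cases "m = k") auto
  have inj: "inj_on ?e {1..k}" and ind: "int_vec.independent (?e ` {1..k})"
    by (rule independent_familyI[OF finite_atLeastAtMost]; rule indep; assumption)+
  have "int_vec.span (?e ` {1..k}) = cone_lattice \<alpha>"
  proof (rule set_eqI)
    fix x
    have "x \<in> int_vec.span (?e ` {1..k}) \<longleftrightarrow>
        (\<exists>c. x = (\<Sum>m\<in>{1..<k}. c m *s edge \<alpha> m) + c k *s f)"
      unfolding in_span_image_iff[OF finite_atLeastAtMost inj] sum_e ..
    also have "\<dots> \<longleftrightarrow> (\<exists>c d. x = (\<Sum>m\<in>{1..<k}. c m *s edge \<alpha> m) + d *s f)"
    proof
      assume "\<exists>c d. x = (\<Sum>m\<in>{1..<k}. c m *s edge \<alpha> m) + d *s f"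
      then obtain c d where "x = (\<Sum>m\<in>{1..<k}. c m *s edge \<alpha> m) + d *s f"
        by blast
      then show "\<exists>c. x = (\<Sum>m\<in>{1..<k}. c m *s edge \<alpha> m) + c k *s f"
        \<comment> \<open>The sum stops before \<open>k\<close>, so the value of \<open>c\<close> at
          \<open>k\<close> is free to hold \<open>d\<close>.\<close>
        by (intro exI[of _ "c(k := d)"]) simp
    qed blast
    finally show "x \<in> int_vec.span (?e ` {1..k}) \<longleftrightarrow> x \<in> cone_lattice \<alpha>"
      by (simp add: lat)
  qed
  then have "zbasis k ?e (cone_lattice \<alpha>)"
    using inj ind by (simp add: zbasis_def)
  moreover have "edge \<alpha> i = (\<Sum>j=1..i. ?a j i *s ?e j)" if i: "i \<in> {1..k}" for i
  proof (cases "i = k")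
    case True
    show ?thesis
      unfolding True sum_e using vk by (simp add: adapted_matrix_def)
  next
    case False
    with i have "1 \<le> i" "i < k" by auto
    then show ?thesis
      unfolding sum_split_last[OF \<open>1 \<le> i\<close>] by (simp add: adapted_matrix_def)
  qed
  ultimately show ?thesis
    unfolding hermite_form_def Let_def len
    using N b k by (auto simp: adapted_matrix_def)
qed

text \<open>Uniqueness half: triangularity determines the columns from left to right, always by
  comparing coefficients in the basis formed by the first \<open>k - 1\<close> edges and
  \<open>f\<close>.\<close>

lemma hermite_form_eq_adapted_matrix:
  assumes rat: "rational_cone k \<alpha>" and k: "1 \<le> k" and ad: "adapted_basis k \<alpha> f N b"
    and b: "\<And>m. m \<in> {1..<k} \<Longrightarrow> 0 \<le> b m \<and> b m < N"
    and H: "hermite_form \<alpha> e a"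
  shows "a = adapted_matrix k N b"
proof -
  have len: "length (edges \<alpha>) = k" and N: "N > 0"
    and lat: "cone_lattice \<alpha> = {x. \<exists>c d. x = (\<Sum>m\<in>{1..<k}. c m *s edge \<alpha> m) + d *s f}"
    and vk: "edge \<alpha> k = (\<Sum>m\<in>{1..<k}. b m *s edge \<alpha> m) + N *s f"
    using rat ad by (simp_all add: rational_cone_def adapted_basis_def)
  have inj: "inj_on e {1..k}" and span: "int_vec.span (e ` {1..k}) = cone_lattice \<alpha>"
    and col: "\<And>i. i \<in> {1..k} \<Longrightarrow> edge \<alpha> i = (\<Sum>j=1..i. a j i *s e j)"
    and pos: "\<And>i. i \<in> {1..k} \<Longrightarrow> a i i > 0"
    and bound: "\<And>i j. i \<in> {1..k} \<Longrightarrow> j \<in> {1..<i} \<Longrightarrow> 0 \<le> a j i \<and> a j i < a i i"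
    and zero: "\<And>i j. \<not> (1 \<le> j \<and> j \<le> i \<and> i \<le> k) \<Longrightarrow> a j i = 0"
    using H unfolding hermite_form_def Let_def len zbasis_def by auto
  note eqD = adapted_basis_eqD[OF rat k ad]
  have e_lat: "\<exists>c d. e m = (\<Sum>m\<in>{1..<k}. c m *s edge \<alpha> m) + d *s f" if "m \<in> {1..k}" for m
    using that int_vec.span_base[of "e m" "e ` {1..k}"] span lat by auto
  \<comment> \<open>Once the earlier \<open>e m\<close> are known to be edges, the coefficient of
    edge \<open>l\<close> in its own column reads \<open>a l l * c l = 1\<close>. Hence the diagonal
    entry is 1, the bounds force the entries above it to be 0, and \<open>e l\<close> is the
    edge.\<close>
  have diag: "a l l = 1 \<and> e l = edge \<alpha> l \<and> (\<forall>j\<in>{1..<l}. a j l = 0)" if "l \<in> {1..<k}" for l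
    using that
  proof (induction l rule: less_induct)
    case (less l)
    have l: "l \<in> {1..k}" "1 \<le> l" "l < k" using less.prems by auto
    obtain c d where el: "e l = (\<Sum>m\<in>{1..<k}. c m *s edge \<alpha> m) + d *s f"
      using e_lat[OF l(1)] by blast
    \<comment> \<open>Zero padding brings the sum to the full range \<open>{1..<k}\<close> on which
      \<open>eqD\<close> compares coefficients.\<close>
    have lower: "(\<Sum>m\<in>{1..<l}. a m l *s e m) = (\<Sum>m\<in>{1..<k}. (if m < l then a m l else 0) *s edge \<alpha> m)"
    proof -
      have "(\<Sum>m\<in>{1..<l}. a m l *s e m) = (\<Sum>m\<in>{1..<l}. (if m < l then a m l else 0) *s edge \<alpha> m)"
        using less.IH l by (intro sum.cong) auto
      also have "\<dots> = (\<Sum>m\<in>{1..<k}. (if m < l then a m l else 0) *s edge \<alpha> m)"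
        using l by (intro sum.mono_neutral_left) auto
      finally show ?thesis .
    qed
    have "edge \<alpha> l = (\<Sum>m\<in>{1..<l}. a m l *s e m) + a l l *s e l"
      using col[OF l(1)] sum_split_last[OF l(2), of "\<lambda>j. a j l *s e j"] by simp
    also have "\<dots> = (\<Sum>m\<in>{1..<k}. ((if m < l then a m l else 0) + a l l * c m) *s edge \<alpha> m)
        + (a l l * d) *s f"
      unfolding lower el
      by (simp add: int_vec.scale_left_distrib int_vec.scale_right_distrib sum.distrib
          int_vec.scale_sum_right)
    finally have "(\<Sum>m\<in>{1..<k}. (if m = l then 1 else 0) *s edge \<alpha> m) + 0 *s f =
        (\<Sum>m\<in>{1..<k}. ((if m < l then a m l else 0) + a l l * c m) *s edge \<alpha> m) + (a l l * d) *s f"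
      using l by (simp add: if_distrib[of "\<lambda>t. t *s _"] sum.delta' cong: if_cong)
    from eqD(2)[OF this, of l] have "a l l * c l = 1"
      using less.prems by simp
    then have all: "a l l = 1"
      using pos[OF l(1)] zmult_eq_1_iff by auto
    moreover have low: "a j l = 0" if "j \<in> {1..<l}" for j
      using bound[OF l(1) that] all by simp
    moreover have "e l = edge \<alpha> l"
      using \<open>edge \<alpha> l = (\<Sum>m\<in>{1..<l}. a m l *s e m) + a l l *s e l\<close> all low by simp
    ultimately show ?case by blast
  qed
  have kk: "k \<in> {1..k}" using k by simp
  have e_sum: "(\<Sum>m\<in>{1..k}. g m *s e m) = (\<Sum>m\<in>{1..<k}. g m *s edge \<alpha> m) + g k *s e k" for g
    unfolding sum_split_last[OF k] using diag by (intro arg_cong2[of _ _ _ _ "(+)"] sum.cong) auto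
  obtain c d where ek: "e k = (\<Sum>m\<in>{1..<k}. c m *s edge \<alpha> m) + d *s f"
    using e_lat[OF kk] by blast
  have e_sum': "(\<Sum>m\<in>{1..k}. g m *s e m) =
      (\<Sum>m\<in>{1..<k}. (g m + g k * c m) *s edge \<alpha> m) + (g k * d) *s f" for g
    unfolding e_sum unfolding ek
    by (simp add: int_vec.scale_left_distrib int_vec.scale_right_distrib sum.distrib
        int_vec.scale_sum_right)
  \<comment> \<open>Since \<open>f\<close> is also a combination of the \<open>e m\<close>, its
    coefficient \<open>d\<close> in \<open>e k\<close> must be a unit; positivity of
    \<open>N\<close> and \<open>a k k\<close> will select \<open>d = 1\<close>.\<close>
  have "f \<in> cone_lattice \<alpha>"
    unfolding lat by (auto intro!: exI[of _ "\<lambda>_. 0"] exI[of _ 1])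
  then obtain g where "f = (\<Sum>m\<in>{1..k}. g m *s e m)"
    using span in_span_image_iff[OF finite_atLeastAtMost inj] by blast
  then have "(\<Sum>m\<in>{1..<k}. 0 *s edge \<alpha> m) + 1 *s f =
      (\<Sum>m\<in>{1..<k}. (g m + g k * c m) *s edge \<alpha> m) + (g k * d) *s f"
    using e_sum' by simp
  from eqD(1)[OF this] have gd: "g k * d = 1" by simp
  have "(\<Sum>m\<in>{1..<k}. b m *s edge \<alpha> m) + N *s f =
      (\<Sum>m\<in>{1..<k}. (a m k + a k k * c m) *s edge \<alpha> m) + (a k k * d) *s f"
    using vk col[OF kk] e_sum'[of "\<lambda>j. a j k"] by simp
  note col_k = eqD[OF this]
  have "d > 0"
    using col_k(1) N pos[OF kk] by (metis zero_less_mult_pos)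
  then have "d = 1"
    using gd zmult_eq_1_iff by auto
  then have akk: "a k k = N"
    using col_k(1) by simp
  have ajk: "a j k = b j" if "j \<in> {1..<k}" for j
  proof -
    \<comment> \<open>Passing from \<open>f\<close> to \<open>e k\<close> alters the last column by
      multiples of \<open>N\<close>, and both columns are reduced.\<close>
    have "b j mod N = a j k mod N"
      using col_k(2)[OF that] akk by simp
    then show ?thesis
      using b[OF that] bound[OF kk that] akk by simp
  qed
  show ?thesis
  proof (intro ext)
    fix j i
    consider "\<not> (1 \<le> j \<and> j \<le> i \<and> i \<le> k)" | "i = k" "j = k" | "i = k" "j \<in> {1..<k}"
      | "i \<in> {1..<k}" "j = i" | "i \<in> {1..<k}" "j \<in> {1..<i}"
      unfolding atLeastLessThan_iff by linarith
    then show "a j i = adapted_matrix k N b j i"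
    proof cases
      case 1
      moreover from 1 k have "adapted_matrix k N b j i = 0"
        by (auto simp: adapted_matrix_def)
      ultimately show ?thesis by (simp only: zero not_False_eq_True)
    next
      case 2
      then show ?thesis by (simp add: adapted_matrix_def akk)
    next
      case 3
      then show ?thesis by (simp add: adapted_matrix_def ajk)
    next
      case 4
      then show ?thesis using diag[of i] by (simp add: adapted_matrix_def)
    next
      case 5
      then show ?thesis using diag[of i] by (simp add: adapted_matrix_def)
    qed
  qed
qed

lemma IARCTAN_eq_adapted_matrix:
  assumes rat: "rational_cone k \<alpha>" and k: "1 \<le> k" and ad: "adapted_basis k \<alpha> f N b"
  shows "IARCTAN \<alpha> = adapted_matrix k N (\<lambda>m. b m mod N)"
proof -
  obtain f' where ad': "adapted_basis k \<alpha> f' N (\<lambda>m. b m mod N)"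
    using adapted_basis_reduce[OF ad] .
  have b: "0 \<le> b m mod N \<and> b m mod N < N" for m
    using ad by (simp add: adapted_basis_def)
  show ?thesis
    unfolding IARCTAN_def
    using adapted_basis_hermite_form[OF rat k ad' b] hermite_form_eq_adapted_matrix[OF rat k ad' b]
    by (intro the_equality) blast+
qed

lemma adapted_basis_lsin_lcos:
  assumes "rational_cone k \<alpha>" "1 \<le> k" "adapted_basis k \<alpha> f N b"
  shows "lsin_at k \<alpha> = N" and "x \<in> {1..<k} \<Longrightarrow> lcos x k \<alpha> = b x mod N"
  unfolding lsin_at_def lcos_def IARCTAN_eq_adapted_matrix[OF assms]
  by (simp_all add: adapted_matrix_def)

section \<open>Divisibility by \<open>N\<close> and its meaning for the lattice\<close>

lemma sum_edges_adapted_basis: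
  assumes k: "1 \<le> k" and ad: "adapted_basis k \<alpha> f N b"
  shows "(\<Sum>m\<in>{1..k}. c m *s edge \<alpha> m) =
    (\<Sum>m\<in>{1..<k}. (c m + c k * b m) *s edge \<alpha> m) + (c k * N) *s f"
proof -
  have "edge \<alpha> k = (\<Sum>m\<in>{1..<k}. b m *s edge \<alpha> m) + N *s f"
    using ad by (simp add: adapted_basis_def)
  then show ?thesis
    unfolding sum_split_last[OF k]
    by (simp add: int_vec.scale_left_distrib int_vec.scale_right_distrib sum.distrib
        int_vec.scale_sum_right)
qed

text \<open>The quotient of the lattice by the span of the edges is cyclic of order
  \<open>N\<close>, generated by the class of \<open>f\<close>. The left side mentions only the
  lattice and the edge set, which makes \<open>N\<close> independent of the order of the
  edges.\<close>

lemma adapted_basis_exponent: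
  assumes rat: "rational_cone k \<alpha>" and k: "1 \<le> k" and ad: "adapted_basis k \<alpha> f N b"
  shows "(\<forall>x\<in>cone_lattice \<alpha>. M *s x \<in> int_vec.span (set (edges \<alpha>))) \<longleftrightarrow> N dvd M"
proof -
  have vk: "edge \<alpha> k = (\<Sum>m\<in>{1..<k}. b m *s edge \<alpha> m) + N *s f"
    and lat: "cone_lattice \<alpha> = {x. \<exists>c d. x = (\<Sum>m\<in>{1..<k}. c m *s edge \<alpha> m) + d *s f}"
    using ad by (simp_all add: adapted_basis_def)
  have edges: "set (edges \<alpha>) = edge \<alpha> ` {1..k}"
    using rat by (intro set_edges) (simp add: rational_cone_def)
  have mem: "edge \<alpha> m \<in> int_vec.span (set (edges \<alpha>))" if "m \<in> {1..k}" for m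
    using that by (intro int_vec.span_base) (auto simp: edges)
  show ?thesis
  proof
    assume "\<forall>x\<in>cone_lattice \<alpha>. M *s x \<in> int_vec.span (set (edges \<alpha>))"
    moreover have "f \<in> cone_lattice \<alpha>"
      unfolding lat by (auto intro!: exI[of _ "\<lambda>_. 0"] exI[of _ 1])
    ultimately obtain c where "M *s f = (\<Sum>m\<in>{1..k}. c m *s edge \<alpha> m)"
      unfolding edges in_span_image_iff[OF finite_atLeastAtMost inj_on_edge[OF rat]] by blast
    then have "(\<Sum>m\<in>{1..<k}. 0 *s edge \<alpha> m) + M *s f =
        (\<Sum>m\<in>{1..<k}. (c m + c k * b m) *s edge \<alpha> m) + (c k * N) *s f"
      unfolding sum_edges_adapted_basis[OF k ad] by simp
    from adapted_basis_eqD(1)[OF rat k ad this] show "N dvd M" by simp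
  next
    assume "N dvd M"
    then obtain q where q: "M = q * N" by (metis dvd_def mult.commute)
    have "N *s f = edge \<alpha> k - (\<Sum>m\<in>{1..<k}. b m *s edge \<alpha> m)"
      using vk by simp
    also have "\<dots> \<in> int_vec.span (set (edges \<alpha>))"
      using mem k by (intro int_vec.span_diff int_vec.span_sum int_vec.span_scale) auto
    finally have Nf: "N *s f \<in> int_vec.span (set (edges \<alpha>))" .
    show "\<forall>x\<in>cone_lattice \<alpha>. M *s x \<in> int_vec.span (set (edges \<alpha>))"
    proof
      fix x assume "x \<in> cone_lattice \<alpha>"
      then obtain c d where "x = (\<Sum>m\<in>{1..<k}. c m *s edge \<alpha> m) + d *s f"
        unfolding lat by blast
      then have "M *s x = M *s (\<Sum>m\<in>{1..<k}. c m *s edge \<alpha> m) + (q * d) *s (N *s f)"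
        by (simp add: q int_vec.scale_right_distrib mult_ac)
      also have "\<dots> \<in> int_vec.span (set (edges \<alpha>))"
        using mem
        by (intro int_vec.span_add[OF int_vec.span_scale int_vec.span_scale[OF Nf]]
            int_vec.span_sum int_vec.span_scale) auto
      finally show "M *s x \<in> int_vec.span (set (edges \<alpha>))" .
    qed
  qed
qed

text \<open>Eliminating the last edge turns the coefficient of edge \<open>x\<close> into
  \<open>c x + c k * b x\<close>, while every coordinate of \<open>N *s y\<close> is a multiple of
  \<open>N\<close>.\<close>

lemma adapted_basis_multiple:
  assumes rat: "rational_cone k \<alpha>" and k: "1 \<le> k" and ad: "adapted_basis k \<alpha> f N b"
    and y: "y \<in> cone_lattice \<alpha>" "(\<Sum>m\<in>{1..k}. c m *s edge \<alpha> m) = N *s y" and x: "x \<in> {1..<k}"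
  shows "N dvd c x + c k * b x"
proof -
  obtain g d where "y = (\<Sum>m\<in>{1..<k}. g m *s edge \<alpha> m) + d *s f"
    using ad y(1) by (auto simp: adapted_basis_def)
  then have "(\<Sum>m\<in>{1..<k}. (c m + c k * b m) *s edge \<alpha> m) + (c k * N) *s f =
      (\<Sum>m\<in>{1..<k}. (N * g m) *s edge \<alpha> m) + (N * d) *s f"
    using y(2) unfolding sum_edges_adapted_basis[OF k ad]
    by (simp add: int_vec.scale_right_distrib int_vec.scale_sum_right)
  from adapted_basis_eqD(2)[OF rat k ad this x] show ?thesis by simp
qed

subsection \<open>Transposed cones\<close>

lemma length_edges_cone_transpose [simp]:
  "length (edges (cone_transpose s \<alpha>)) = length (edges \<alpha>)"
  by (simp add: cone_transpose_def del: upt_Suc)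

lemma edge_cone_transpose:
  assumes "length (edges \<alpha>) = k" "m \<in> {1..k}"
  shows "edge (cone_transpose s \<alpha>) m = edge \<alpha> (s m)"
proof -
  have "edge (cone_transpose s \<alpha>) m =
      map (\<lambda>i. edge \<alpha> (s i)) [1..<Suc k] ! (m - 1)"
    using assms(1) by (simp add: cone_transpose_def edge_def[of "_\<lparr>edges := _\<rparr>"])
  also have "\<dots> = edge \<alpha> (s m)"
    using assms(2) by (subst nth_map) (auto simp del: upt_Suc)
  finally show ?thesis .
qed

lemma set_edges_cone_transpose:
  assumes "length (edges \<alpha>) = k" "s permutes {1..k}"
  shows "set (edges (cone_transpose s \<alpha>)) = set (edges \<alpha>)"
proof -
  have "set (edges (cone_transpose s \<alpha>)) = edge (cone_transpose s \<alpha>) ` {1..k}"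
    using assms(1) by (intro set_edges) simp
  also have "\<dots> = edge \<alpha> ` s ` {1..k}"
    unfolding image_image using edge_cone_transpose[OF assms(1)] by (intro image_cong) auto
  also have "\<dots> = set (edges \<alpha>)"
    using assms by (simp add: permutes_image set_edges)
  finally show ?thesis .
qed

lemma rational_cone_cone_transpose:
  assumes "rational_cone k \<alpha>" "s permutes {1..k}"
  shows "rational_cone k (cone_transpose s \<alpha>)"
proof -
  have len: "length (edges \<alpha>) = k" and "distinct (edges \<alpha>)"
    using assms(1) by (simp_all add: rational_cone_def)
  \<comment> \<open>A list with the same set and the same length as a distinct list is
    distinct.\<close>
  then have "distinct (edges (cone_transpose s \<alpha>))"
    using set_edges_cone_transpose[OF len assms(2)]
    by (intro card_distinct) (simp add: distinct_card)
  then show ?thesis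
    using assms(1) set_edges_cone_transpose[OF len assms(2)] by (simp add: rational_cone_def)
qed

text \<open>Facets are determined by the vertex, the set of edges and their number, and a
  permutation preserves all three.\<close>

lemma simple_cone_cone_transpose:
  assumes "length (edges \<alpha>) = k" "s permutes {1..k}" "simple_cone \<alpha>"
  shows "simple_cone (cone_transpose s \<alpha>)"
proof -
  have "vertex (cone_transpose s \<alpha>) = vertex \<alpha>"
    by (simp add: cone_transpose_def)
  then have "facet \<beta> (cone_transpose s \<alpha>) \<longleftrightarrow> facet \<beta> \<alpha>" for \<beta>
    using set_edges_cone_transpose[OF assms(1,2)] by (simp add: facet_def)
  then show ?thesis
    using assms(3) by (simp add: simple_cone_def)
qed

lemma cone_lattice_cone_transpose:
  assumes "length (edges \<alpha>) = k" "s permutes {1..k}"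
  shows "cone_lattice (cone_transpose s \<alpha>) = cone_lattice \<alpha>"
  using set_edges_cone_transpose[OF assms] by (simp add: cone_lattice_def)

text \<open>The permutation fixes \<open>k\<close>, so the last edge stays in place and the other
  basis vectors are merely relabelled.\<close>

lemma adapted_basis_permute_facet:
  assumes len: "length (edges \<alpha>) = k" and k: "1 \<le> k" and ad: "adapted_basis k \<alpha> f N b"
    and s: "s permutes {1..<k}"
  shows "adapted_basis k (cone_transpose s \<alpha>) f N (b \<circ> s)"
proof -
  have s': "s permutes {1..k}"
    by (rule permutes_subset[OF s]) auto
  have "s k = k"
    using s by (simp add: permutes_not_in)
  then have vk: "edge (cone_transpose s \<alpha>) k = edge \<alpha> k"
    using edge_cone_transpose[OF len] k by simp
  have sums: "(\<Sum>m\<in>{1..<k}. c (s m) *s edge (cone_transpose s \<alpha>) m) =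
      (\<Sum>m\<in>{1..<k}. c m *s edge \<alpha> m)" for c
  proof -
    have "(\<Sum>m\<in>{1..<k}. c m *s edge \<alpha> m) = (\<Sum>m\<in>{1..<k}. c (s m) *s edge \<alpha> (s m))"
      using sum.permute[OF s, of "\<lambda>m. c m *s edge \<alpha> m"] by (simp add: comp_def)
    also have "\<dots> = (\<Sum>m\<in>{1..<k}. c (s m) *s edge (cone_transpose s \<alpha>) m)"
      using edge_cone_transpose[OF len] by (intro sum.cong) auto
    finally show ?thesis ..
  qed
  have "{x. \<exists>c d. x = (\<Sum>m\<in>{1..<k}. c m *s edge \<alpha> m) + d *s f} =
      {x. \<exists>c d. x = (\<Sum>m\<in>{1..<k}. c m *s edge (cone_transpose s \<alpha>) m) + d *s f}"
  proof (intro Collect_cong iffI)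
    fix x
    assume "\<exists>c d. x = (\<Sum>m\<in>{1..<k}. c m *s edge \<alpha> m) + d *s f"
    then obtain c d where "x = (\<Sum>m\<in>{1..<k}. c m *s edge \<alpha> m) + d *s f"
      by blast
    then show "\<exists>c d. x = (\<Sum>m\<in>{1..<k}. c m *s edge (cone_transpose s \<alpha>) m) + d *s f"
      unfolding sums[symmetric] by (intro exI)
  next
    fix x
    assume "\<exists>c d. x = (\<Sum>m\<in>{1..<k}. c m *s edge (cone_transpose s \<alpha>) m) + d *s f"
    then obtain c d where "x = (\<Sum>m\<in>{1..<k}. c m *s edge (cone_transpose s \<alpha>) m) + d *s f"
      by blast
    \<comment> \<open>Reading the relabelled sum backwards requires coefficients whose composition
      with \<open>s\<close> is \<open>c\<close>.\<close>
    then have "x = (\<Sum>m\<in>{1..<k}. c (inv s m) *s edge \<alpha> m) + d *s f"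
      using sums[of "\<lambda>m. c (inv s m)"] by (simp only: permutes_inverses(2)[OF s])
    then show "\<exists>c d. x = (\<Sum>m\<in>{1..<k}. c m *s edge \<alpha> m) + d *s f"
      by (intro exI)
  qed
  then show ?thesis
    using ad unfolding adapted_basis_def comp_def cone_lattice_cone_transpose[OF len s'] vk sums[of b]
    by (simp only: simp_thms)
qed

text \<open>Both numbers have the same multiples, because the exponent criterion is the same for the
  two cones; being positive, they agree.\<close>

lemma adapted_basis_transpose_factor:
  assumes rat: "rational_cone k \<alpha>" and s: "s permutes {1..k}" and k: "1 \<le> k"
    and ad: "adapted_basis k \<alpha> f N b"
    and ad': "adapted_basis k (cone_transpose s \<alpha>) f' N' b'"
  shows "N' = N"
proof -
  have len: "length (edges \<alpha>) = k"
    using rat by (simp add: rational_cone_def)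
  have "N dvd M \<longleftrightarrow> N' dvd M" for M
    using adapted_basis_exponent[OF rat k ad, of M]
      adapted_basis_exponent[OF rational_cone_cone_transpose[OF rat s] k ad', of M]
      cone_lattice_cone_transpose[OF len s] set_edges_cone_transpose[OF len s]
    by simp
  from this[of N] this[of N'] have "N' dvd N" "N dvd N'" by simp_all
  then show ?thesis
    using ad ad' by (simp add: adapted_basis_def zdvd_antisym_nonneg)
qed

text \<open>The basis of the transposed cone expresses edge \<open>i\<close> through edge
  \<open>k\<close> and the others, up to a multiple of \<open>N\<close>; this relation is tested in
  the original basis. The common \<open>N\<close> is justified by
  \<open>adapted_basis_transpose_factor\<close>.\<close>

lemma adapted_basis_exchange:
  assumes rat: "rational_cone k \<alpha>" and i: "i \<in> {1..<k}"
    and ad: "adapted_basis k \<alpha> f N b"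
    and ad': "adapted_basis k (cone_transpose (Transposition.transpose i k) \<alpha>) f' N b'"
  shows "[b' i * b i = 1] (mod N)"
    and "\<And>x. x \<in> {1..<k} \<Longrightarrow> x \<noteq> i \<Longrightarrow> [b' x = - b x * b' i] (mod N)"
proof -
  let ?s = "Transposition.transpose i k"
  let ?\<beta> = "cone_transpose ?s \<alpha>"
  have len: "length (edges \<alpha>) = k"
    using rat by (simp add: rational_cone_def)
  have k: "1 \<le> k" and s: "?s permutes {1..k}"
    using i by (auto intro!: permutes_swap_id)
  have "f' \<in> cone_lattice ?\<beta>"
    using ad' by (auto simp: adapted_basis_def intro!: exI[of _ "\<lambda>_. 0"] exI[of _ 1])
  then have f': "f' \<in> cone_lattice \<alpha>"
    by (simp add: cone_lattice_cone_transpose[OF len s])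
  have edge_k: "edge ?\<beta> k = edge \<alpha> i" and edge_i: "edge ?\<beta> i = edge \<alpha> k"
    and edge_other: "\<And>m. m \<in> {1..<k} - {i} \<Longrightarrow> edge ?\<beta> m = edge \<alpha> m"
    using edge_cone_transpose[OF len] i by auto
  \<comment> \<open>Coefficients of edge \<open>i\<close> minus its expansion in the transposed
    cone. Edge \<open>k\<close> now occupies position \<open>i\<close> there, so it receives
    \<open>- b' i\<close>.\<close>
  define c where "c m = (if m = i then 1 else if m = k then - b' i else - b' m)" for m
  define T where "T = (\<Sum>m\<in>{1..<k} - {i}. b' m *s edge \<alpha> m)"
  have "edge \<alpha> i = (\<Sum>m\<in>{1..<k}. b' m *s edge ?\<beta> m) + N *s f'"
    using ad' edge_k by (simp add: adapted_basis_def)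
  also have "(\<Sum>m\<in>{1..<k}. b' m *s edge ?\<beta> m) =
      b' i *s edge \<alpha> k + (\<Sum>m\<in>{1..<k} - {i}. b' m *s edge ?\<beta> m)"
    using i edge_i by (simp add: sum.remove[of _ i])
  also have "(\<Sum>m\<in>{1..<k} - {i}. b' m *s edge ?\<beta> m) = T"
    unfolding T_def using edge_other by (intro sum.cong) auto
  finally have vi: "edge \<alpha> i = b' i *s edge \<alpha> k + T + N *s f'" .
  have "(\<Sum>m\<in>{1..<k}. c m *s edge \<alpha> m) = edge \<alpha> i + (\<Sum>m\<in>{1..<k} - {i}. c m *s edge \<alpha> m)"
    using i by (simp add: sum.remove[of _ i] c_def)
  also have "(\<Sum>m\<in>{1..<k} - {i}. c m *s edge \<alpha> m) = - T"
    unfolding T_def sum_negf[symmetric] by (intro sum.cong) (auto simp: c_def)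
  finally have "(\<Sum>m\<in>{1..k}. c m *s edge \<alpha> m) = N *s f'"
    unfolding sum_split_last[OF k] vi using i by (simp add: c_def)
  note dvd = adapted_basis_multiple[OF rat k ad f' this]
  have "N dvd - (b' i * b i - 1)"
    \<comment> \<open>At \<open>x = i\<close> the divided number is \<open>1 - b' i * b i\<close>;
      the outer minus puts it in the form of a congruence.\<close>
    using dvd[OF i] i by (simp add: c_def)
  then show "[b' i * b i = 1] (mod N)"
    by (simp only: cong_iff_dvd_diff dvd_minus_iff)
  show "[b' x = - b x * b' i] (mod N)" if "x \<in> {1..<k}" "x \<noteq> i" for x
  proof -
    have "N dvd - (b' x - - b x * b' i)"
      using dvd[OF that(1)] that i by (simp add: c_def algebra_simps)
    then show ?thesis
      by (simp only: cong_iff_dvd_diff dvd_minus_iff)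
  qed
qed

section \<open>Modular inverses and the two kinds of transposition\<close>

text \<open>Evaluate the product of \<open>c\<close>, the residue of \<open>a\<close> and its
  inverse with both bracketings. The inverse is taken of \<open>a mod N\<close> because that residue
  is the cosine.\<close>

lemma cong_modular_inverse_unique:
  fixes a c N :: int
  assumes "[c * a = 1] (mod N)"
  shows "[c = modular_inverse N (a mod N)] (mod N)"
proof -
  let ?a = "a mod N"
  have ca: "[c * ?a = 1] (mod N)"
    using assms by (simp add: cong_def mod_mult_right_eq)
  then have "coprime ?a N"
    by (auto simp: coprime_iff_invertible_int mult.commute)
  then have "[c * (?a * modular_inverse N ?a) = c * 1] (mod N)"
    by (intro cong_mult cong_refl cong_modular_inverse1)
  moreover have "[c * ?a * modular_inverse N ?a = 1 * modular_inverse N ?a] (mod N)"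
    by (intro cong_mult cong_refl ca)
  ultimately show ?thesis
    unfolding mult.assoc mult_1 mult.right_neutral by (rule cong_trans[OF cong_sym])
qed

theorem proposition3p4:
  fixes \<alpha> :: "('n::finite) ordered_cone" and k i j :: nat and \<sigma> :: "nat \<Rightarrow> nat"
  assumes "k \<ge> 2"
    and "rational_cone k \<alpha>"
    and "simple_cone \<alpha>"
    and "1 \<le> i" and "i < j" and "j \<le> k"
    and "\<sigma> = Transposition.transpose i j"
  shows "(j < k \<longrightarrow>
            (\<forall>x\<in>{1..k - 1}. lcos x k (cone_transpose \<sigma> \<alpha>) = lcos (\<sigma> x) k \<alpha>)) \<and>
         (j = k \<longrightarrow>
            (\<forall>x\<in>{1..k - 1}.
               [lcos x k (cone_transpose \<sigma> \<alpha>) =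
                  (if x = i then modular_inverse (lsin_at k \<alpha>) (lcos i k \<alpha>)
                   else - lcos x k \<alpha> * modular_inverse (lsin_at k \<alpha>) (lcos i k \<alpha>))]
               (mod lsin_at k \<alpha>)))"
proof (intro conjI impI ballI)
  have k: "1 \<le> k" and len: "length (edges \<alpha>) = k"
    using assms(1,2) by (simp_all add: rational_cone_def)
  have s: "\<sigma> permutes {1..k}"
    using assms(4-7) by (auto intro!: permutes_swap_id)
  note rat' = rational_cone_cone_transpose[OF assms(2) s]
  obtain f N b where ad: "adapted_basis k \<alpha> f N b"
    using adapted_basis_exists[OF assms(2,3) k] .
  note entries = adapted_basis_lsin_lcos[OF assms(2) k ad]
  {
    fix x assume "j < k" and x: "x \<in> {1..k - 1}"
    \<comment> \<open>For \<open>j < k\<close> the transposition does not move \<open>k\<close>, so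
      the same \<open>f\<close> and \<open>N\<close> serve both cones.\<close>
    then have s': "\<sigma> permutes {1..<k}" and x': "x \<in> {1..<k}"
      using assms(4-7) by (auto intro!: permutes_swap_id)
    have "lcos x k (cone_transpose \<sigma> \<alpha>) = (b \<circ> \<sigma>) x mod N"
      using adapted_basis_lsin_lcos(2)[OF rat' k adapted_basis_permute_facet[OF len k ad s'] x'] .
    also have "\<dots> = lcos (\<sigma> x) k \<alpha>"
      using entries(2)[of "\<sigma> x"] permutes_in_image[OF s'] x' by simp
    finally show "lcos x k (cone_transpose \<sigma> \<alpha>) = lcos (\<sigma> x) k \<alpha>" .
  }
  {
    fix x assume "j = k" and x: "x \<in> {1..k - 1}"
    then have x': "x \<in> {1..<k}" and i: "i \<in> {1..<k}"
      and \<sigma>: "\<sigma> = Transposition.transpose i k"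
      using assms(4-7) by auto
    obtain f' N' b' where ad': "adapted_basis k (cone_transpose \<sigma> \<alpha>) f' N' b'"
      using adapted_basis_exists[OF rat' simple_cone_cone_transpose[OF len s assms(3)] k] .
    have "N' = N"
      using adapted_basis_transpose_factor[OF assms(2) s k ad ad'] .
    with ad' have ad': "adapted_basis k (cone_transpose \<sigma> \<alpha>) f' N b'"
      by simp
    note exchange = adapted_basis_exchange[OF assms(2) i ad ad'[unfolded \<sigma>]]
    \<comment> \<open>The cosine is the residue of \<open>b' x\<close>; working with congruences
      allows the unreduced entry from here on.\<close>
    have entry': "[lcos x k (cone_transpose \<sigma> \<alpha>) = b' x] (mod N)"
      using adapted_basis_lsin_lcos(2)[OF rat' k ad' x'] by (simp add: cong_def)
    have inverse: "[b' i = modular_inverse N (lcos i k \<alpha>)] (mod N)"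
      using cong_modular_inverse_unique[OF exchange(1)] entries(2)[OF i] by simp
    have "[b' x = - lcos x k \<alpha> * modular_inverse N (lcos i k \<alpha>)] (mod N)" if "x \<noteq> i"
    proof -
      have "[- b x = - lcos x k \<alpha>] (mod N)"
        unfolding cong_minus_minus_iff using entries(2)[OF x'] by (simp add: cong_def)
      then show ?thesis
        by (rule cong_trans[OF exchange(2)[OF x' that] cong_mult[OF _ inverse]])
    qed
    with inverse have "[b' x = (if x = i then modular_inverse N (lcos i k \<alpha>)
        else - lcos x k \<alpha> * modular_inverse N (lcos i k \<alpha>))] (mod N)"
      by (cases "x = i") simp_all
    then show "[lcos x k (cone_transpose \<sigma> \<alpha>) =
        (if x = i then modular_inverse (lsin_at k \<alpha>) (lcos i k \<alpha>)
         else - lcos x k \<alpha> * modular_inverse (lsin_at k \<alpha>) (lcos i k \<alpha>))] (mod lsin_at k \<alpha>)"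
      unfolding entries(1) by (rule cong_trans[OF entry'])
  }
qed

end
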